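(* Let $G$ be an equitably 4-colorable graph on $n\ge 2$ vertices and let $k\ge 3$, $l\ge 1$ be integers. Then $\chi_{=}(G\circ^l C_{2k})\le 4$.
   Context: All graphs are finite, simple and connected. $C_m$ denotes the cycle on $m$ vertices. A graph is equitably $k$-colorable if its vertex set can be partitioned into $k$ (possibly empty) independent sets $V_1,\dots,V_k$ with $||V_i|-|V_j||\le 1$ for all $i,j$; $\chi_{=}(G)$ is the least $k$ for which $G$ is equitably $k$-colorable. The corona $G\circ H$ is formed from one copy of $G$ and $|V(G)|$ copies of $H$, the $i$-th vertex of $G$ being joined to every vertex of the $i$-th copy of $H$; $G\circ^1 H=G\circ H$ and $G\circ^l H=(G\circ^{l-1}H)\circ H$ for $l\ge 2$. *)

theory Defs
  imports "Graph_Theory.Graph_Theory" "HOL-Library.Disjoint_Sets"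
begin

text \<open>Finite simple graphs are the library's \<open>pair_graph\<close>s: finite, symmetric, loop-free digraphs
  without parallel arcs; an edge $uv$ is the pair of arcs $(u,v)$, $(v,u)$.\<close>

definition cycle_graph :: "nat \<Rightarrow> nat pair_pre_digraph" where
  "cycle_graph m =
     \<lparr> pverts = {..<m},
       parcs = {(i, j). i < m \<and> j < m \<and> (j = Suc i mod m \<or> i = Suc j mod m)} \<rparr>"


subsection \<open>Equitable colorings\<close>

definition independent_set :: "'a pair_pre_digraph \<Rightarrow> 'a set \<Rightarrow> bool" where
  "independent_set G S \<longleftrightarrow> S \<subseteq> pverts G \<and> (\<forall>u\<in>S. \<forall>v\<in>S. (u, v) \<notin> parcs G)"

definition equitably_colorable :: "'a pair_pre_digraph \<Rightarrow> nat \<Rightarrow> bool" where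
  "equitably_colorable G k \<longleftrightarrow>
     (\<exists>V :: nat \<Rightarrow> 'a set.
        (\<Union>i<k. V i) = pverts G \<and>
        disjoint_family_on V {..<k} \<and>
        (\<forall>i<k. independent_set G (V i)) \<and>
        (\<forall>i<k. \<forall>j<k. \<bar>int (card (V i)) - int (card (V j))\<bar> \<le> 1))"

definition equitable_chromatic_number :: "'a pair_pre_digraph \<Rightarrow> nat" where
  "equitable_chromatic_number G = (LEAST k. equitably_colorable G k)"

text \<open>The minimum is attained for every finite simple graph.\<close>

lemma equitably_colorable_card:
  assumes "pair_graph G"
  shows "equitably_colorable G (card (pverts G))"
proof -
  interpret pair_graph G by fact
  obtain f where f: "bij_betw f {..<card (pverts G)} (pverts G)"
    using ex_bij_betw_nat_finite[OF pair_finite_verts] by (auto simp: atLeast0LessThan)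
  have "(\<Union>i<card (pverts G). {f i}) = pverts G"
    using f by (auto simp: bij_betw_def)
  moreover have "disjoint_family_on (\<lambda>i. {f i}) {..<card (pverts G)}"
    using f by (auto simp: bij_betw_def disjoint_family_on_def inj_on_def)
  moreover have "\<forall>i<card (pverts G). independent_set G {f i}"
    using f pair_no_loops by (fastforce simp: independent_set_def bij_betw_def)
  ultimately show ?thesis
    unfolding equitably_colorable_def by (intro exI[of _ "\<lambda>i. {f i}"]) auto
qed


subsection \<open>Coronas\<close>

text \<open>\<open>Inl u\<close> is the vertex \<open>u\<close> of \<open>G\<close>; \<open>Inr (u, x)\<close> is the vertex \<open>x\<close> in the copy of \<open>H\<close>
  belonging to \<open>u\<close>.\<close>

definition corona ::
  "'a pair_pre_digraph \<Rightarrow> 'b pair_pre_digraph \<Rightarrow> ('a + 'a \<times> 'b) pair_pre_digraph" where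
  "corona G H =
     \<lparr> pverts = Inl ` pverts G \<union> Inr ` (pverts G \<times> pverts H),
       parcs = {(Inl u, Inl v) | u v. (u, v) \<in> parcs G}
             \<union> {(Inr (u, x), Inr (u, y)) | u x y. u \<in> pverts G \<and> (x, y) \<in> parcs H}
             \<union> {(Inl u, Inr (u, x)) | u x. u \<in> pverts G \<and> x \<in> pverts H}
             \<union> {(Inr (u, x), Inl u) | u x. u \<in> pverts G \<and> x \<in> pverts H} \<rparr>"

text \<open>The vertex type of \<open>corona G H\<close> differs from that of \<open>G\<close>, so in order to iterate, the vertices
  are renamed injectively into one recursive type that serves for all iterates. The iterates are thus
  given up to isomorphism; see the lemmas \<open>corona_iter_1\<close> and \<open>corona_iter_Suc\<close>.\<close>

datatype ('a, 'b) corona_vertex =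
    Base 'a
  | Old "('a, 'b) corona_vertex"
  | New "('a, 'b) corona_vertex" 'b

fun corona_vertex_of ::
  "('a, 'b) corona_vertex + ('a, 'b) corona_vertex \<times> 'b \<Rightarrow> ('a, 'b) corona_vertex" where
  "corona_vertex_of (Inl v) = Old v"
| "corona_vertex_of (Inr (v, x)) = New v x"

definition rename_verts :: "('a \<Rightarrow> 'b) \<Rightarrow> 'a pair_pre_digraph \<Rightarrow> 'b pair_pre_digraph" where
  "rename_verts f G = \<lparr> pverts = f ` pverts G, parcs = map_prod f f ` parcs G \<rparr>"

primrec corona_iter ::
  "'a pair_pre_digraph \<Rightarrow> nat \<Rightarrow> 'b pair_pre_digraph \<Rightarrow> ('a, 'b) corona_vertex pair_pre_digraph" where
  "corona_iter G 0 H = rename_verts Base G"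
| "corona_iter G (Suc l) H = rename_verts corona_vertex_of (corona (corona_iter G l H) H)"

lemma inj_corona_vertex_of: "inj corona_vertex_of"
proof (rule injI)
  fix p q :: "('a, 'b) corona_vertex + ('a, 'b) corona_vertex \<times> 'b"
  assume "corona_vertex_of p = corona_vertex_of q"
  then show "p = q"
    by (cases p rule: corona_vertex_of.cases; cases q rule: corona_vertex_of.cases) auto
qed

lemma pair_wf_digraph_rename_verts:
  assumes "pair_wf_digraph G"
  shows "pair_wf_digraph (rename_verts f G)"
  using assms by (fastforce simp: pair_wf_digraph_def rename_verts_def)

lemma pair_wf_digraph_corona:
  assumes "pair_wf_digraph G" "pair_wf_digraph H"
  shows "pair_wf_digraph (corona G H)"
  using assms by (fastforce simp: pair_wf_digraph_def corona_def)

lemma pair_wf_digraph_corona_iter: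
  assumes "pair_wf_digraph G" "pair_wf_digraph H"
  shows "pair_wf_digraph (corona_iter G l H)"
  by (induction l)
    (auto intro: pair_wf_digraph_rename_verts pair_wf_digraph_corona assms)

lemma digraph_iso_rename_verts:
  assumes "pair_wf_digraph G" "inj f"
  shows "digraph_iso (with_proj G) (with_proj (rename_verts f G))"
proof -
  interpret pair_wf_digraph G by fact
  let ?h = "\<lparr> iso_verts = f, iso_arcs = map_prod f f, iso_head = snd, iso_tail = fst \<rparr>"
  have "pre_digraph.digraph_isomorphism (with_proj G) ?h"
    using assms(2) wf_digraph
    by (auto simp: pre_digraph.digraph_isomorphism_def inj_on_def)
  moreover have "with_proj (rename_verts f G) = app_iso ?h (with_proj G)"
    by (simp add: with_proj_def rename_verts_def app_iso_def)
  ultimately show ?thesis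
    unfolding digraph_iso_def by blast
qed

lemma corona_iter_Suc:
  assumes "pair_wf_digraph G" "pair_wf_digraph H"
  shows "digraph_iso (with_proj (corona (corona_iter G l H) H)) (with_proj (corona_iter G (Suc l) H))"
  using assms
  by (simp add: digraph_iso_rename_verts inj_corona_vertex_of pair_wf_digraph_corona
      pair_wf_digraph_corona_iter)

lemma corona_iter_1:
  assumes "pair_wf_digraph G" "pair_wf_digraph H"
  shows "digraph_iso (with_proj (corona G H)) (with_proj (corona_iter G 1 H))"
proof -
  let ?f = "map_sum Base (map_prod Base id) :: 'a + 'a \<times> 'b \<Rightarrow> ('a, 'b) corona_vertex + _ \<times> 'b"
  have "corona (rename_verts Base G) H = rename_verts ?f (corona G H)"
  proof (rule pair_pre_digraph.equality)
    show "pverts (corona (rename_verts Base G) H) = pverts (rename_verts ?f (corona G H))"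
      by (simp add: corona_def rename_verts_def image_Un image_image)
        (rule arg_cong2[where f = "(\<union>)"], simp, force)
    show "parcs (corona (rename_verts Base G) H) = parcs (rename_verts ?f (corona G H))"
      (is "?L = ?R")
    proof
      show "?L \<subseteq> ?R"
      proof
        fix p assume "p \<in> ?L"
        then consider
            u v where "p = (Inl (Base u), Inl (Base v))" "(u, v) \<in> parcs G"
          | u x y where "p = (Inr (Base u, x), Inr (Base u, y))" "u \<in> pverts G" "(x, y) \<in> parcs H"
          | u x where "p = (Inl (Base u), Inr (Base u, x))" "u \<in> pverts G" "x \<in> pverts H"
          | u x where "p = (Inr (Base u, x), Inl (Base u))" "u \<in> pverts G" "x \<in> pverts H"
          unfolding corona_def rename_verts_def by auto
        then show "p \<in> ?R"
        proof cases
          case 1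
          then have "(Inl u, Inl v) \<in> parcs (corona G H)" by (simp add: corona_def)
          from map_prod_imageI[OF this, of ?f ?f] 1 show ?thesis by (simp add: rename_verts_def)
        next
          case 2
          then have "(Inr (u, x), Inr (u, y)) \<in> parcs (corona G H)" by (simp add: corona_def)
          from map_prod_imageI[OF this, of ?f ?f] 2 show ?thesis by (simp add: rename_verts_def)
        next
          case 3
          then have "(Inl u, Inr (u, x)) \<in> parcs (corona G H)" by (simp add: corona_def)
          from map_prod_imageI[OF this, of ?f ?f] 3 show ?thesis by (simp add: rename_verts_def)
        next
          case 4
          then have "(Inr (u, x), Inl u) \<in> parcs (corona G H)" by (simp add: corona_def)
          from map_prod_imageI[OF this, of ?f ?f] 4 show ?thesis by (simp add: rename_verts_def)
        qed
      qed
      show "?R \<subseteq> ?L"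
        by (auto simp: corona_def rename_verts_def)
    qed
  qed simp
  then have "corona_iter G 1 H = rename_verts (corona_vertex_of \<circ> ?f) (corona G H)"
    by (simp add: rename_verts_def image_comp prod.map_comp)
  moreover have "inj (corona_vertex_of \<circ> ?f)"
    by (intro inj_compose inj_corona_vertex_of sum.inj_map prod.inj_map) (auto intro: injI)
  ultimately show ?thesis
    using digraph_iso_rename_verts[OF pair_wf_digraph_corona[OF assms]] by metis
qed

end

theory Submission
  imports Defs
begin

text \<open>It suffices to pass from \<open>G\<close> to a single corona. Given an equitable 4-coloring of \<open>G\<close>, color the
  copy of \<open>C\<^bsub>2k\<^esub>\<close> at \<open>u\<close> by a color \<open>p\<close> on the even vertices and by two further
  colors, used \<open>x\<close> and \<open>k - x\<close> times, on the odd vertices, avoiding the color of \<open>u\<close>. Four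
  base vertices of four different colors can then be treated cyclically so that together they contribute
  \<open>2k + 1\<close> vertices to every color class. Removing such quadruples leaves 0, 2, 3 or 5
  base vertices (5 rather than 1, where a balanced choice need not exist), for which explicit choices
  work.\<close>

section \<open>Equitable 4-colorings as color functions, and renaming of vertices\<close>

definition balanced :: "(nat \<Rightarrow> nat) \<Rightarrow> bool" where
  "balanced t \<longleftrightarrow> (\<forall>i<4. \<forall>j<4. t i \<le> Suc (t j))"

text \<open>Disjointness gives each vertex a unique class index, which serves as its color;
  conversely, the fibers of \<open>c\<close> are the classes. Color functions extend to a corona
  more easily than indexed partitions, and \<open>balanced\<close>, read over all ordered pairs,
  replaces the absolute value.\<close>

lemma equitably_colorable_4_iff:
  assumes "finite (pverts G)"
  shows "equitably_colorable G 4 \<longleftrightarrow>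
    (\<exists>c. (\<forall>v\<in>pverts G. c v < 4) \<and>
         (\<forall>u\<in>pverts G. \<forall>v\<in>pverts G. (u, v) \<in> parcs G \<longrightarrow> c u \<noteq> c v) \<and>
         balanced (\<lambda>i. card {v \<in> pverts G. c v = i}))" (is "?L \<longleftrightarrow> ?R")
proof
  assume ?L
  then obtain V :: "nat \<Rightarrow> 'a set" where V: "(\<Union>i<4. V i) = pverts G" "disjoint_family_on V {..<4}"
    "\<forall>i<4. independent_set G (V i)"
    "\<forall>i<4. \<forall>j<4. \<bar>int (card (V i)) - int (card (V j))\<bar> \<le> 1"
    unfolding equitably_colorable_def by blast
  have "\<forall>v\<in>pverts G. \<exists>i. i < 4 \<and> v \<in> V i" using V(1) by blast
  then obtain c where c: "\<forall>v\<in>pverts G. c v < 4 \<and> v \<in> V (c v)" by metis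
  have cl: "{v \<in> pverts G. c v = i} = V i" if "i < 4" for i
    using V(1,2) c that unfolding disjoint_family_on_def by fastforce
  show ?R
  proof (intro exI[of _ c] conjI ballI impI)
    fix u v assume "u \<in> pverts G" "v \<in> pverts G" "(u, v) \<in> parcs G"
    then show "c u \<noteq> c v" using V(3) c unfolding independent_set_def by metis
  next
    show "balanced (\<lambda>i. card {v \<in> pverts G. c v = i})"
      unfolding balanced_def
    proof (intro allI impI)
      fix i j :: nat assume "i < 4" "j < 4"
      then show "card {v \<in> pverts G. c v = i} \<le> Suc (card {v \<in> pverts G. c v = j})"
        using V(4)[rule_format, of i j] by (simp add: cl)
    qed
  qed (use c in auto)
next
  assume ?R
  then obtain c where c: "\<forall>v\<in>pverts G. c v < (4::nat)"
    "\<forall>u\<in>pverts G. \<forall>v\<in>pverts G. (u, v) \<in> parcs G \<longrightarrow> c u \<noteq> c v"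
    and b: "balanced (\<lambda>i. card {v \<in> pverts G. c v = i})" by blast
  have "\<bar>int (card {v \<in> pverts G. c v = i}) - int (card {v \<in> pverts G. c v = j})\<bar> \<le> 1"
    if "i < 4" "j < 4" for i j
    using b[unfolded balanced_def, rule_format, OF that]
      b[unfolded balanced_def, rule_format, OF that(2,1)] by simp
  moreover have "independent_set G {v \<in> pverts G. c v = i}" for i
    unfolding independent_set_def using c(2) by fastforce
  ultimately show ?L
    unfolding equitably_colorable_def
    using c(1) by (intro exI[of _ "\<lambda>i. {v \<in> pverts G. c v = i}"])
      (auto simp: disjoint_family_on_def)
qed

lemma equitably_colorable_rename_verts:
  assumes "equitably_colorable G k" "inj f"
  shows "equitably_colorable (rename_verts f G) k"
proof -
  obtain V :: "nat \<Rightarrow> 'a set" where V: "(\<Union>i<k. V i) = pverts G" "disjoint_family_on V {..<k}"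
    "\<forall>i<k. independent_set G (V i)"
    "\<forall>i<k. \<forall>j<k. \<bar>int (card (V i)) - int (card (V j))\<bar> \<le> 1"
    using assms(1) unfolding equitably_colorable_def by blast
  have "card (f ` V i) = card (V i)" for i
    using assms(2) by (meson card_image inj_on_subset subset_UNIV)
  moreover have "(\<Union>i<k. f ` V i) = f ` pverts G" using V(1) by blast
  moreover have "disjoint_family_on (\<lambda>i. f ` V i) {..<k}"
    using V(2) by (simp add: disjoint_family_on_def image_Int[OF assms(2), symmetric])
  moreover have "independent_set (rename_verts f G) (f ` V i)" if "i < k" for i
    using V(3) that assms(2) by (auto simp: independent_set_def rename_verts_def inj_eq)
  ultimately show ?thesis
    using V(4) unfolding equitably_colorable_def
    by (intro exI[of _ "\<lambda>i. f ` V i"]) (auto simp: rename_verts_def)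
qed

lemma finite_pverts_rename_verts:
  "finite (pverts G) \<Longrightarrow> finite (pverts (rename_verts f G))"
  by (simp add: rename_verts_def)

lemma card_pverts_rename_verts:
  "inj f \<Longrightarrow> card (pverts (rename_verts f G)) = card (pverts G)"
  unfolding rename_verts_def by (simp, meson card_image inj_on_subset subset_UNIV)

section \<open>Colorings of one even cycle and their class sizes\<close>

definition cycle_coloring :: "nat \<Rightarrow> nat \<Rightarrow> nat \<Rightarrow> nat \<Rightarrow> nat \<Rightarrow> nat" where
  "cycle_coloring p q r x j = (if even j then p else if j div 2 < x then q else r)"

text \<open>For \<open>x <= k\<close>, the number of vertices of color \<open>d\<close> when the
  cycle on \<open>2 * k\<close> vertices is colored by \<open>cycle_coloring p q r x\<close>. As a
  sum of indicators it also covers \<open>q = r\<close>, where one color fills all odd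
  vertices.\<close>

definition cycle_class_size :: "nat \<Rightarrow> nat \<Rightarrow> nat \<Rightarrow> nat \<Rightarrow> nat \<Rightarrow> nat \<Rightarrow> nat" where
  "cycle_class_size k p q r x d = k * of_bool (p = d) + x * of_bool (q = d) + (k - x) * of_bool (r = d)"

text \<open>The class sizes offered for the copy at a base vertex of color \<open>e\<close>. Keeping
  only sizes turns the search for an equitable coloring into arithmetic.\<close>

definition cycle_class_sizes :: "nat \<Rightarrow> nat \<Rightarrow> (nat \<Rightarrow> nat) set" where
  "cycle_class_sizes k e = {cycle_class_size k p q r x | p q r x.
     {p, q, r} \<subseteq> {..<4} - {e} \<and> p \<noteq> q \<and> p \<noteq> r \<and> x \<le> k}"

lemma sum_lessThan_double:
  fixes g :: "nat \<Rightarrow> 'a :: comm_monoid_add"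
  shows "(\<Sum>j<2 * k. g j) = (\<Sum>i<k. g (2 * i)) + (\<Sum>i<k. g (Suc (2 * i)))"
  by (induction k) (auto simp: algebra_simps)

lemma card_cycle_coloring_class:
  assumes "x \<le> k"
  shows "card {j \<in> {..<2 * k}. cycle_coloring p q r x j = d} = cycle_class_size k p q r x d"
proof -
  have split: "(\<Sum>i<k. of_bool ((if i < x then q else r) = d))
      = x * of_bool (q = d) + (k - x) * (of_bool (r = d) :: nat)"
    using assms
  proof (induction k)
    case (Suc k)
    \<comment> \<open>If \<open>x <= k\<close>, the induction hypothesis applies; otherwise
      \<open>x = Suc k\<close> and every summand compares \<open>q\<close> with
      \<open>d\<close>.\<close>
    then show ?case by (cases "x \<le> k") (auto simp: Suc_diff_le le_Suc_eq)
  qed simp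
  have "card {j \<in> {..<2 * k}. cycle_coloring p q r x j = d}
      = (\<Sum>j<2 * k. of_bool (cycle_coloring p q r x j = d))"
    by (simp add: Int_def)
  also have "\<dots> = cycle_class_size k p q r x d"
    unfolding sum_lessThan_double
    by (simp add: cycle_coloring_def cycle_class_size_def split)
  finally show ?thesis .
qed

text \<open>Reduction modulo the even number \<open>2 * k\<close> preserves parity, so adjacent
  vertices have opposite parity: one has color \<open>p\<close>, the other \<open>q\<close> or
  \<open>r\<close>.\<close>

lemma cycle_coloring_proper:
  assumes "(i, j) \<in> parcs (cycle_graph (2 * k))" "p \<noteq> q" "p \<noteq> r"
  shows "cycle_coloring p q r x i \<noteq> cycle_coloring p q r x j"
proof -
  have "even (Suc m mod (2 * k)) \<longleftrightarrow> odd m" for m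
    using dvd_mod_iff[of 2 "2 * k" "Suc m"] by simp
  then have "even i \<longleftrightarrow> odd j"
    using assms(1) by (auto simp: cycle_graph_def)
  then show ?thesis using assms(2,3) by (auto simp: cycle_coloring_def)
qed

text \<open>With \<open>w u\<close> the class sizes in the copy at \<open>u\<close>, this is the
  size of color class \<open>d\<close> on \<open>S\<close> together with its copies.\<close>

definition class_total :: "'a set \<Rightarrow> ('a \<Rightarrow> nat) \<Rightarrow> ('a \<Rightarrow> nat \<Rightarrow> nat) \<Rightarrow> nat \<Rightarrow> nat" where
  "class_total S c w d = (\<Sum>u\<in>S. of_bool (c u = d) + w u d)"

section \<open>Balanced choices of class sizes over the base vertices\<close>

lemma lessThan_4: "{..<4} = {0, 1, 2, 3::nat}"
  by auto

lemma cycle_class_sizesI: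
  assumes "p < 4" "q < 4" "r < 4" "p \<noteq> q" "p \<noteq> r" "e \<noteq> p" "e \<noteq> q" "e \<noteq> r" "x \<le> k"
  shows "cycle_class_size k p q r x \<in> cycle_class_sizes k e"
  using assms unfolding cycle_class_sizes_def by auto

lemma balanced_iff:
  assumes "{..<4} = {a, b, d, e}"
  shows "balanced t \<longleftrightarrow> (\<forall>i\<in>{a, b, d, e}. \<forall>j\<in>{a, b, d, e}. t i \<le> Suc (t j))"
  unfolding balanced_def assms[symmetric] by auto

text \<open>Names the colors absent from given base vertices, so that totals can be compared without
  a case distinction on numerical colors.\<close>

lemma color_completion:
  assumes "distinct xs" "set xs \<subseteq> {..<n::nat}"
  obtains ys where "distinct (xs @ ys)" "set (xs @ ys) = {..<n}" "length xs + length ys = n"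
proof -
  define ys where "ys = sorted_list_of_set ({..<n} - set xs)"
  have "distinct (xs @ ys)" and eq: "set (xs @ ys) = {..<n}"
    using assms by (auto simp: ys_def)
  moreover have "length xs + length ys = n"
    using distinct_card[OF \<open>distinct (xs @ ys)\<close>] by (simp only: eq card_lessThan length_append)
  ultimately show thesis using that by blast
qed

text \<open>Each copy takes the color of the other base vertex on its even vertices and its own one
  of the two absent colors on all odd vertices.\<close>

lemma balanced_choice_2:
  assumes "u \<noteq> v" "c u \<noteq> c v" "c u < 4" "c v < 4"
  shows "\<exists>w. (\<forall>u\<in>{u, v}. w u \<in> cycle_class_sizes k (c u)) \<and> balanced (class_total {u, v} c w)"
proof -
  obtain ys where ys: "distinct ([c u, c v] @ ys)" "set ([c u, c v] @ ys) = {..<4}"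
    "length [c u, c v] + length ys = 4"
    using color_completion[of "[c u, c v]" 4] assms by auto
  then obtain d e where [simp]: "ys = [d, e]" by (auto simp: numeral_eq_Suc length_Suc_conv)
  have C: "{..<4} = {c u, c v, d, e}" using ys(2) by simp
  then have lt: "d < 4" "e < 4" by auto
  define w where "w = (\<lambda>_. undefined)(u := cycle_class_size k (c v) d d k, v := cycle_class_size k (c u) e e k)"
  have w: "w u = cycle_class_size k (c v) d d k" "w v = cycle_class_size k (c u) e e k"
    using assms(1) by (simp_all add: w_def)
  have "\<forall>u\<in>{u, v}. w u \<in> cycle_class_sizes k (c u)"
    using ys(1) assms lt by (auto simp: w intro!: cycle_class_sizesI)
  moreover have "class_total {u, v} c w (c u) = k + 1" "class_total {u, v} c w (c v) = k + 1"
    "class_total {u, v} c w d = k" "class_total {u, v} c w e = k"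
    using ys(1) assms(1) by (simp_all add: class_total_def cycle_class_size_def w)
  then have "balanced (class_total {u, v} c w)"
    unfolding balanced_iff[OF C] by simp
  ultimately show ?thesis by blast
qed

text \<open>The choice is invariant under rotating the three base vertices, so their colors have
  equal totals. Balance then only asks that \<open>4 * y\<close> differ from
  \<open>2 * k + 1\<close> by at most 1, which dictates the value of \<open>y\<close>.\<close>

lemma balanced_choice_3:
  assumes "distinct [u, v, z]" "distinct [c u, c v, c z]" "c u < 4" "c v < 4" "c z < 4"
  shows "\<exists>w. (\<forall>u\<in>{u, v, z}. w u \<in> cycle_class_sizes k (c u)) \<and> balanced (class_total {u, v, z} c w)"
proof -
  obtain ys where ys: "distinct ([c u, c v, c z] @ ys)" "set ([c u, c v, c z] @ ys) = {..<4}"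
    "length [c u, c v, c z] + length ys = 4"
    using color_completion[of "[c u, c v, c z]" 4] assms by auto
  then obtain e where [simp]: "ys = [e]" by (auto simp: numeral_eq_Suc length_Suc_conv)
  have C: "{..<4} = {c u, c v, c z, e}" using ys(2) by simp
  then have lt: "e < 4" by auto
  define y where "y = (k + 1) div 2"
  \<comment> \<open>The colors present get \<open>2 * k + 1 - y\<close> vertices each, the missing color \<open>3 * y\<close>.\<close>
  have y: "y \<le> k" "3 * y \<le> Suc (Suc (k + (k - y)))" "Suc (k + (k - y)) \<le> Suc (3 * y)"
    unfolding y_def by presburger+
  define w where "w = (\<lambda>_. undefined)(u := cycle_class_size k (c v) e (c z) y,
    v := cycle_class_size k (c z) e (c u) y, z := cycle_class_size k (c u) e (c v) y)"
  have w: "w u = cycle_class_size k (c v) e (c z) y" "w v = cycle_class_size k (c z) e (c u) y"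
    "w z = cycle_class_size k (c u) e (c v) y"
    using assms(1) by (simp_all add: w_def)
  have "\<forall>u\<in>{u, v, z}. w u \<in> cycle_class_sizes k (c u)"
    using ys(1) assms lt y(1) by (auto simp: w intro!: cycle_class_sizesI)
  moreover have "class_total {u, v, z} c w (c u) = Suc (k + (k - y))"
    "class_total {u, v, z} c w (c v) = Suc (k + (k - y))"
    "class_total {u, v, z} c w (c z) = Suc (k + (k - y))"
    "class_total {u, v, z} c w e = 3 * y"
    using ys(1) assms(1) by (simp_all add: class_total_def cycle_class_size_def w)
  then have "balanced (class_total {u, v, z} c w)"
    unfolding balanced_iff[OF C] using y(2,3) by simp
  ultimately show ?thesis by blast
qed

text \<open>Replaces the case of one base vertex: there the color of that vertex would occur once
  and \<open>p\<close> at least \<open>k\<close> times, which is unbalanced for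
  \<open>k >= 3\<close>. Keeping one quadruple gives enough room.\<close>

lemma balanced_choice_5:
  assumes "distinct [t, u, v, y, z]" "{..<4} = {c u, c v, c y, c z}" "distinct [c u, c v, c y, c z]"
    "c t = c u" "k \<ge> 1"
  shows "\<exists>w. (\<forall>u\<in>{t, u, v, y, z}. w u \<in> cycle_class_sizes k (c u)) \<and>
    balanced (class_total {t, u, v, y, z} c w)"
proof -
  define x where "x = (k + 1) div 2"
  \<comment> \<open>As in the case of three vertices, \<open>v\<close> has the color missing among \<open>u, y, z\<close>; the parity of \<open>k\<close>
    decides whether that color is then in excess or in deficit, and \<open>t, v\<close> compensate for it.\<close>
  define w where "w = (\<lambda>_. undefined)(
    t := (if even k then cycle_class_size k (c v) (c y) (c y) k else cycle_class_size k (c y) (c z) (c v) 1),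
    v := (if even k then cycle_class_size k (c u) (c z) (c z) k else cycle_class_size k (c u) (c y) (c z) 1),
    u := cycle_class_size k (c y) (c v) (c z) x,
    y := cycle_class_size k (c z) (c v) (c u) x,
    z := cycle_class_size k (c u) (c v) (c y) x)"
  have w: "w t = (if even k then cycle_class_size k (c v) (c y) (c y) k else cycle_class_size k (c y) (c z) (c v) 1)"
    "w v = (if even k then cycle_class_size k (c u) (c z) (c z) k else cycle_class_size k (c u) (c y) (c z) 1)"
    "w u = cycle_class_size k (c y) (c v) (c z) x"
    "w y = cycle_class_size k (c z) (c v) (c u) x"
    "w z = cycle_class_size k (c u) (c v) (c y) x"
    using assms(1) by (auto simp: w_def)
  have x: "x \<le> k" using assms(5) by (simp add: x_def)
  have lt: "c u < 4" "c v < 4" "c y < 4" "c z < 4" using assms(2) by auto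
  have "\<forall>u\<in>{t, u, v, y, z}. w u \<in> cycle_class_sizes k (c u)"
    using assms(1,3-5) lt x by (auto simp: w intro!: cycle_class_sizesI)
  moreover have "balanced (class_total {t, u, v, y, z} c w)"
  \<comment> \<open>The \<open>5 * (2 * k + 1)\<close> vertices leave remainder 1 modulo 4 for even
    \<open>k\<close> and 3 for odd \<open>k\<close>: one class is larger by one, respectively
    smaller by one, than the other three.\<close>
  proof (cases "even k")
    case True
    then obtain h where "k = 2 * h" by (blast elim: evenE)
    then have h: "k = 2 * h" "x = h" by (simp_all add: x_def)
    have "class_total {t, u, v, y, z} c w (c u) = 5 * h + 2"
      "class_total {t, u, v, y, z} c w (c v) = 5 * h + 1"
      "class_total {t, u, v, y, z} c w (c y) = 5 * h + 1"
      "class_total {t, u, v, y, z} c w (c z) = 5 * h + 1"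
      using assms(1,3,4) by (simp_all add: class_total_def cycle_class_size_def w h)
    then show ?thesis
      unfolding balanced_iff[OF assms(2)] by simp
  next
    case False
    then obtain h where "k = 2 * h + 1" by (blast elim: oddE)
    then have h: "k = 2 * h + 1" "x = h + 1" by (simp_all add: x_def)
    have "class_total {t, u, v, y, z} c w (c u) = 5 * h + 4"
      "class_total {t, u, v, y, z} c w (c v) = 5 * h + 4"
      "class_total {t, u, v, y, z} c w (c y) = 5 * h + 4"
      "class_total {t, u, v, y, z} c w (c z) = 5 * h + 3"
      using assms(1,3,4) by (simp_all add: class_total_def cycle_class_size_def w h)
    then show ?thesis
      unfolding balanced_iff[OF assms(2)] by simp
  qed
  ultimately show ?thesis by blast
qed

text \<open>The copy at a vertex of color \<open>i\<close> uses \<open>i + 1\<close> on even and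
  \<open>i + 2\<close> on odd vertices, modulo 4. Each color thus gains one base vertex and
  \<open>k\<close> vertices in each of two copies; a constant gain preserves balance.\<close>

lemma balanced_choice_add_4:
  assumes "finite S" "\<forall>u\<in>S. w u \<in> cycle_class_sizes k (c u)" "balanced (class_total S c w)"
    "\<forall>i<4. v i \<notin> S \<and> c (v i) = i"
  shows "\<exists>w. (\<forall>u\<in>S \<union> v ` {..<4}. w u \<in> cycle_class_sizes k (c u)) \<and>
    balanced (class_total (S \<union> v ` {..<4}) c w)"
proof -
  define w' where "w' u = (if u \<in> S then w u else
    cycle_class_size k ((c u + 1) mod 4) ((c u + 2) mod 4) ((c u + 2) mod 4) k)" for u
  have ext_S: "w' u = w u" if "u \<in> S" for u using that by (simp add: w'_def)
  have inj: "inj_on v {..<4}" using assms(4) by (metis inj_onI lessThan_iff)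
  have "w' (v i) \<in> cycle_class_sizes k (c (v i))" if "i < 4" for i
  proof -
    have "i \<in> {0, 1, 2, 3}" using that by auto
    then show ?thesis
      using assms(4) that by (auto simp: w'_def intro!: cycle_class_sizesI)
  qed
  then have "\<forall>u\<in>S \<union> v ` {..<4}. w' u \<in> cycle_class_sizes k (c u)"
    using assms(2) ext_S by auto
  moreover have tot: "class_total (S \<union> v ` {..<4}) c w' d = class_total S c w d + (2 * k + 1)" if "d < 4" for d
  proof -
    have "class_total (S \<union> v ` {..<4}) c w' d = class_total S c w' d + class_total (v ` {..<4}) c w' d"
      unfolding class_total_def using assms(1,4) by (intro sum.union_disjoint) auto
    also have "class_total S c w' d = class_total S c w d"
      unfolding class_total_def by (intro sum.cong) (auto simp: ext_S)
    also have "class_total (v ` {..<4}) c w' d = (\<Sum>i<4. of_bool (c (v i) = d) + w' (v i) d)"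
      unfolding class_total_def by (simp add: sum.reindex[OF inj])
    also have "\<dots> = (\<Sum>i<4. of_bool (i = d) +
        cycle_class_size k ((i + 1) mod 4) ((i + 2) mod 4) ((i + 2) mod 4) k d)"
      using assms(4) by (intro sum.cong) (auto simp: w'_def)
    also have "\<dots> = 2 * k + 1"
    proof -
      have "d \<in> {0, 1, 2, 3}" using that by auto
      then show ?thesis by (auto simp: lessThan_4 cycle_class_size_def)
    qed
    finally show ?thesis .
  qed
  then have "balanced (class_total (S \<union> v ` {..<4}) c w')"
    using assms(3) by (simp add: balanced_def)
  ultimately show ?thesis by blast
qed

text \<open>Strong induction on the number of base vertices. If a color is absent, balance bounds
  every class by 1, leaving at most three vertices of distinct colors. Otherwise a quadruple of all
  four colors is split off, unless a single vertex would remain.\<close>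

lemma ex_balanced_choice:
  assumes "finite S" "\<forall>u\<in>S. c u < 4" "card S \<noteq> 1" "k \<ge> 1" "balanced (\<lambda>i. card {u \<in> S. c u = i})"
  shows "\<exists>w. (\<forall>u\<in>S. w u \<in> cycle_class_sizes k (c u)) \<and> balanced (class_total S c w)"
  using assms(1-3,5)
proof (induction "card S" arbitrary: S rule: less_induct)
  case less
  show ?case
  proof (cases "\<exists>i<4. card {u \<in> S. c u = i} = 0")
    case True
    then have le1: "card {u \<in> S. c u = i} \<le> 1" if "i < 4" for i
      using less.prems(4) that by (fastforce simp: balanced_def)
    have inj: "inj_on c S"
    proof (rule inj_onI)
      fix x y assume "x \<in> S" "y \<in> S" "c x = c y"
      then show "x = y"
        using le1[of "c x"] less.prems(1,2) card_le_Suc0_iff_eq[of "{u \<in> S. c u = c x}"] by auto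
    qed
    obtain i where i: "i < 4" "i \<notin> c ` S" using True less.prems(1) by auto
    then have "c ` S \<subset> {..<4}" using less.prems(2) by auto
    then have "card S < 4"
      using psubset_card_mono[of "{..<4}" "c ` S"] by (simp add: card_image[OF inj])
    then consider "S = {}" | "card S = 2" | "card S = 3"
      using less.prems(1,3) by (fastforce simp: numeral_eq_Suc less_Suc_eq)
    then show ?thesis
    proof cases
      case 1
      then show ?thesis by (simp add: balanced_def class_total_def)
    next
      case 2
      then obtain u v where S: "S = {u, v}" "u \<noteq> v" by (auto simp: card_2_iff)
      show ?thesis
        unfolding S(1)
        by (rule balanced_choice_2) (use S inj less.prems(2) in auto)
    next
      case 3
      then obtain u v z where S: "S = {u, v, z}" "distinct [u, v, z]" by (auto simp: card_3_iff)
      show ?thesis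
        unfolding S(1)
        by (rule balanced_choice_3) (use S inj less.prems(2) in auto)
    qed
  next
    case False
    then have "\<forall>i<4. \<exists>u. u \<in> S \<and> c u = i"
      by (metis (mono_tags, lifting) Collect_empty_eq card.empty)
    then obtain v where v: "\<forall>i<4. v i \<in> S \<and> c (v i) = i" by metis
    define T where "T = S - v ` {..<4}"
    have injv: "inj_on v {..<4}" using v by (metis inj_onI lessThan_iff)
    have S: "S = T \<union> v ` {..<4}" using v by (auto simp: T_def)
    have fT: "finite T" using less.prems(1) by (simp add: T_def)
    have cT: "card S = card T + 4"
      using fT by (subst S, subst card_Un_disjoint) (auto simp: T_def card_image[OF injv])
    show ?thesis
    proof (cases "card T = 1")
      case True
      then obtain t where T: "T = {t}" by (auto simp: card_1_singleton_iff)
      have t: "t \<in> S" "c t < 4" using T less.prems(2) by (auto simp: T_def)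
      obtain ys where ys: "distinct ([c t] @ ys)" "set ([c t] @ ys) = {..<4}"
        "length [c t] + length ys = 4"
        using color_completion[of "[c t]" 4] t by auto
      then obtain a b d where [simp]: "ys = [a, b, d]" by (auto simp: numeral_eq_Suc length_Suc_conv)
      have C: "{..<4} = {c t, a, b, d}" using ys(2) by simp
      then have lt: "a < 4" "b < 4" "d < 4" by auto
      have tv: "v i \<noteq> t" if "i < 4" for i using T that by (auto simp: T_def)
      \<comment> \<open>The member of the quadruple that shares the color of \<open>t\<close> is
        listed right after it, as \<open>balanced_choice_5\<close> expects.\<close>
      have "S = {t, v (c t), v a, v b, v d}" unfolding S T C by auto
      moreover have "\<exists>w. (\<forall>u\<in>{t, v (c t), v a, v b, v d}. w u \<in> cycle_class_sizes k (c u)) \<and>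
        balanced (class_total {t, v (c t), v a, v b, v d} c w)"
      proof (rule balanced_choice_5)
        show "distinct [t, v (c t), v a, v b, v d]"
          using ys(1) v lt t tv by (auto, (metis)+)
      qed (use C ys(1) v lt t assms(4) in auto)
      ultimately show ?thesis by metis
    next
      case False
      \<comment> \<open>Every class loses exactly one vertex, so \<open>T\<close> inherits balance
        from \<open>S\<close>.\<close>
      have cls: "card {u \<in> S. c u = i} = Suc (card {u \<in> T. c u = i})" if "i < 4" for i
      proof -
        have "{u \<in> S. c u = i} = insert (v i) {u \<in> T. c u = i}"
          using v that by (auto simp: S)
        then show ?thesis using fT that by (simp add: T_def)
      qed
      have "balanced (\<lambda>i. card {u \<in> T. c u = i})"
        using less.prems(4) by (simp add: balanced_def cls)
      then obtain w where "\<forall>u\<in>T. w u \<in> cycle_class_sizes k (c u)" "balanced (class_total T c w)"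
        using less.hyps[of T] cT fT False less.prems(2) by (auto simp: T_def)
      then show ?thesis
        unfolding S using v by (intro balanced_choice_add_4[OF fT]) (auto simp: T_def)
    qed
  qed
qed

section \<open>Coloring one corona and iterating\<close>

lemma finite_pverts_corona:
  assumes "finite (pverts G)" "finite (pverts H)"
  shows "finite (pverts (corona G H))"
  using assms by (simp add: corona_def)

lemma card_pverts_corona_ge:
  assumes "finite (pverts G)" "finite (pverts H)"
  shows "card (pverts G) \<le> card (pverts (corona G H))"
proof -
  have "card (pverts G) = card (Inl ` pverts G :: ('a + 'a \<times> 'b) set)"
    by (simp add: card_image)
  also have "\<dots> \<le> card (pverts (corona G H))"
    using finite_pverts_corona[OF assms] by (intro card_mono) (auto simp: corona_def)
  finally show ?thesis .
qed

text \<open>A balanced choice of sizes is realized by coloring the copy at each \<open>u\<close>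
  with a matching \<open>cycle_coloring\<close>. Its colors avoid \<open>c u\<close>, so the edges
  joining \<open>u\<close> to its copy are proper too.\<close>

lemma equitably_colorable_corona_even_cycle:
  assumes "finite (pverts G)" "card (pverts G) \<noteq> 1" "k \<ge> 1" "equitably_colorable G 4"
  shows "equitably_colorable (corona G (cycle_graph (2 * k))) 4"
proof -
  let ?H = "cycle_graph (2 * k)" and ?S = "pverts G"
  have H: "pverts ?H = {..<2 * k}" by (simp add: cycle_graph_def)
  obtain c where c: "\<forall>v\<in>?S. c v < 4"
    "\<forall>u\<in>?S. \<forall>v\<in>?S. (u, v) \<in> parcs G \<longrightarrow> c u \<noteq> c v"
    "balanced (\<lambda>i. card {v \<in> ?S. c v = i})"
    using assms(4) unfolding equitably_colorable_4_iff[OF assms(1)] by blast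
  obtain w where w: "\<forall>u\<in>?S. w u \<in> cycle_class_sizes k (c u)" "balanced (class_total ?S c w)"
    using ex_balanced_choice[OF assms(1) c(1) assms(2,3) c(3)] by blast
  \<comment> \<open>\<open>w\<close> records sizes only; the parameters of an actual coloring are
    recovered here for each base vertex.\<close>
  have "\<forall>u\<in>?S. \<exists>p q r x. w u = cycle_class_size k p q r x \<and>
      {p, q, r} \<subseteq> {..<4} - {c u} \<and> p \<noteq> q \<and> p \<noteq> r \<and> x \<le> k"
    using w(1) unfolding cycle_class_sizes_def by blast
  then obtain p q r x where pqrx: "\<forall>u\<in>?S. w u = cycle_class_size k (p u) (q u) (r u) (x u) \<and>
      {p u, q u, r u} \<subseteq> {..<4} - {c u} \<and> p u \<noteq> q u \<and> p u \<noteq> r u \<and> x u \<le> k"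
    by metis
  define g where "g u = cycle_coloring (p u) (q u) (r u) (x u)" for u
  have g: "g u j < 4 \<and> g u j \<noteq> c u" if "u \<in> ?S" for u j
    using pqrx that by (auto simp: g_def cycle_coloring_def)
  have g': "g u i \<noteq> g u j" if "u \<in> ?S" "(i, j) \<in> parcs ?H" for u i j
    using cycle_coloring_proper[OF that(2)] pqrx that(1) by (auto simp: g_def)
  define f where "f = case_sum c (\<lambda>(u, j). g u j)"
  have cls: "card {v \<in> pverts (corona G ?H). f v = d} = class_total ?S c w d" for d
  proof -
    let ?A = "Inl ` {u \<in> ?S. c u = d} :: ('a + 'a \<times> nat) set"
    let ?B = "Inr ` (SIGMA u:?S. {j \<in> {..<2 * k}. g u j = d}) :: ('a + 'a \<times> nat) set"
    have "{v \<in> pverts (corona G ?H). f v = d} = ?A \<union> ?B"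
      by (auto simp: corona_def f_def H)
    also have "card \<dots> = card ?A + card ?B"
      using assms(1) by (intro card_Un_disjoint) auto
    also have "card ?A = (\<Sum>u\<in>?S. of_bool (c u = d))"
      using assms(1) by (simp add: card_image Int_def)
    also have "card ?B = (\<Sum>u\<in>?S. card {j \<in> {..<2 * k}. g u j = d})"
      using assms(1) by (simp add: card_image)
    also have "\<dots> = (\<Sum>u\<in>?S. w u d)"
    proof (intro sum.cong refl)
      fix u assume "u \<in> ?S"
      then show "card {j \<in> {..<2 * k}. g u j = d} = w u d"
        unfolding g_def using pqrx by (subst card_cycle_coloring_class) auto
    qed
    finally show ?thesis by (simp add: class_total_def sum.distrib)
  qed
  have "finite (pverts (corona G ?H))"
    using assms(1) by (simp add: finite_pverts_corona H)
  moreover have "\<forall>v\<in>pverts (corona G ?H). f v < 4"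
    using c(1) g by (auto simp: corona_def f_def)
  moreover have "\<forall>u\<in>pverts (corona G ?H). \<forall>v\<in>pverts (corona G ?H).
      (u, v) \<in> parcs (corona G ?H) \<longrightarrow> f u \<noteq> f v"
    using c(2) g g' by (fastforce simp: corona_def f_def)
  moreover have "balanced (\<lambda>d. card {v \<in> pverts (corona G ?H). f v = d})"
    using w(2) by (simp add: cls)
  ultimately show ?thesis
    by (subst equitably_colorable_4_iff) blast+
qed

text \<open>The induction on \<open>l\<close> carries finiteness and the bound 2 on the number of
  vertices along with colorability, as the step for one corona asks for a finite base that is not a
  single vertex. The bound persists because a corona contains its base.\<close>

lemma equitably_colorable_corona_iter_even_cycle:
  assumes "finite (pverts G)" "card (pverts G) \<ge> 2" "k \<ge> 1" "equitably_colorable G 4"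
  shows "equitably_colorable (corona_iter G l (cycle_graph (2 * k))) 4"
proof -
  let ?H = "cycle_graph (2 * k)"
  have H: "finite (pverts ?H)" by (simp add: cycle_graph_def)
  have "finite (pverts (corona_iter G l ?H)) \<and> card (pverts (corona_iter G l ?H)) \<ge> 2 \<and>
    equitably_colorable (corona_iter G l ?H) 4"
  proof (induction l)
    case 0
    have "inj (Base :: 'a \<Rightarrow> ('a, nat) corona_vertex)" by (rule injI) simp
    then show ?case
      using assms by (simp add: equitably_colorable_rename_verts card_pverts_rename_verts finite_pverts_rename_verts)
  next
    case (Suc l)
    let ?K = "corona_iter G l ?H"
    have "card (pverts (corona ?K ?H)) \<ge> 2"
      using card_pverts_corona_ge[of ?K ?H] Suc H by simp
    moreover have "equitably_colorable (corona ?K ?H) 4"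
      using equitably_colorable_corona_even_cycle[of ?K k] Suc assms(3) by simp
    moreover have "finite (pverts (corona ?K ?H))"
      using finite_pverts_corona Suc H by blast
    ultimately show ?case
      by (simp add: inj_corona_vertex_of equitably_colorable_rename_verts card_pverts_rename_verts finite_pverts_rename_verts)
  qed
  then show ?thesis by blast
qed

theorem theorem3:
  fixes G :: "'a pair_pre_digraph" and k l :: nat
  assumes "pair_graph G"
    and "Digraph_Component.connected (with_proj G)"
    and "card (pverts G) \<ge> 2"
    and "equitably_colorable G 4"
    and "k \<ge> 3"
    and "l \<ge> 1"
  shows "equitable_chromatic_number (corona_iter G l (cycle_graph (2 * k))) \<le> 4"
proof -
  interpret pair_graph G by fact
  have "equitably_colorable (corona_iter G l (cycle_graph (2 * k))) 4"
    using assms by (intro equitably_colorable_corona_iter_even_cycle) auto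
  then show ?thesis
    unfolding equitable_chromatic_number_def by (rule Least_le)
qed

end
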